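(* (Necessity.) Let $\alpha_1,\alpha_2,\alpha_3,\alpha_4\in[0,1)$ and let $\lambda=a+ib\in\sigma(A(\alpha_1,\alpha_2,\alpha_3,\alpha_4))$ with $a,b\in\mathbb{R}$, $b\ne 0$. Then (1) $0\le a<1$; (2) $a+|b|\le 1$; (3) $G(a,b)\ge 0$. (Converse.) If $a,b\in\mathbb{R}$ satisfy $b>0$, $0\le a<1$, $a+b<1$ and $G(a,b)>0$, then there exist $\alpha_1,\alpha_2,\alpha_3,\alpha_4\in[0,1)$ such that $a+ib\in\sigma(A(\alpha_1,\alpha_2,\alpha_3,\alpha_4))$; in other words, every point strictly inside $\{b>0,\ 0\le a<1,\ a+b<1,\ G(a,b)>0\}$ is realized as an eigenvalue of a $4$-cycle stochastic matrix. The analogous statement for the lower half-plane (with $b<0$ and $a+|b|<1$) also holds. (Boundary.) Moreover: (i) for every $x\in(0,1]$, the point $1-x+ix$ is an eigenvalue of $A(1-x,1-x,1-x,1-x)$, and the point $1$ (corresponding to $x=0$) is an eigenvalue of a $4$-cycle stochastic matrix; (ii) every point of the curve portion $C_L^+:=\{a+ib:\ b>0,\ a\ge 0,\ a+b\le 1,\ G(a,b)=0\}$ is an eigenvalue of $A_L(\alpha)$ for some $\alpha\in[0,1)$; the endpoint $0$ of this curve portion is not an eigenvalue of any $A_L(\alpha)$, $\alpha\in[0,1)$, but is a limit point of the set of nonreal eigenvalues so realized.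
   Context: For $\alpha_1,\alpha_2,\alpha_3,\alpha_4\in[0,1)$, the $4$-cycle stochastic matrix is $$A(\alpha_1,\alpha_2,\alpha_3,\alpha_4)=\begin{pmatrix}\alpha_1&1-\alpha_1&0&0\\0&\alpha_2&1-\alpha_2&0\\0&0&\alpha_3&1-\alpha_3\\1-\alpha_4&0&0&\alpha_4\end{pmatrix}.$$ $\sigma(A)$ denotes the spectrum of $A$. For real $a,b$, $G(a,b):=(b^2+a^2+a)^2+2a^2-b^2$. For $\alpha\in[0,1)$, $$A_L(\alpha)=A(\alpha,0,0,0)=\begin{pmatrix}\alpha&1-\alpha&0&0\\0&0&1&0\\0&0&0&1\\1&0&0&0\end{pmatrix}.$$ *)

theory Defs
  imports
    "HOL-Analysis.Elementary_Topology"
    "Jordan_Normal_Form.Spectral_Radius"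
begin

definition cycle_mat :: "real \<Rightarrow> real \<Rightarrow> real \<Rightarrow> real \<Rightarrow> real mat" where
  "cycle_mat \<alpha>1 \<alpha>2 \<alpha>3 \<alpha>4 = mat_of_rows_list 4
    [[\<alpha>1,     1 - \<alpha>1, 0,      0],
     [0,      \<alpha>2,     1 - \<alpha>2, 0],
     [0,      0,      \<alpha>3,     1 - \<alpha>3],
     [1 - \<alpha>4, 0,      0,      \<alpha>4]]"

definition cycle_mat_L :: "real \<Rightarrow> real mat" where
  "cycle_mat_L \<alpha> = cycle_mat \<alpha> 0 0 0"

(* The library spectrum of a real matrix contains only its real eigenvalues,
   hence the passage to complex entries. *)
definition complex_spectrum :: "real mat \<Rightarrow> complex set" where
  "complex_spectrum A = spectrum (map_mat complex_of_real A)"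

definition G :: "real \<Rightarrow> real \<Rightarrow> real" where
  "G a b = (b\<^sup>2 + a\<^sup>2 + a)\<^sup>2 + 2 * a\<^sup>2 - b\<^sup>2"

definition C_L_plus :: "complex set" where
  "C_L_plus = {Complex a b | a b. b > 0 \<and> a \<ge> 0 \<and> a + b \<le> 1 \<and> G a b = 0}"

end

theory Submission
  imports Defs "HOL-Analysis.Elementary_Metric_Spaces"
begin

text \<open>
  The spectrum consists of the solutions of
  \<open>(z - \<alpha>1) (z - \<alpha>2) (z - \<alpha>3) (z - \<alpha>4) = (1 - \<alpha>1) (1 - \<alpha>2) (1 - \<alpha>3) (1 - \<alpha>4)\<close>.

  Necessity is a convexity argument. Let \<open>z = a + i b\<close> with \<open>b > 0\<close>, and let \<open>t\<^sub>j\<close> in \<open>(0, pi)\<close> be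
  the argument of \<open>z - \<alpha>\<^sub>j\<close>. Comparing arguments, \<open>t\<^sub>1 + t\<^sub>2 + t\<^sub>3 + t\<^sub>4 = 2 pi\<close>. Comparing moduli,
  the numbers \<open>(1 - \<alpha>\<^sub>j) / \<bar>z - \<alpha>\<^sub>j\<bar> = cos t\<^sub>j + c sin t\<^sub>j\<close>, where \<open>c = (1 - a) / b\<close>, have product
  \<open>1\<close>. The logarithm of \<open>cos t + c sin t\<close> is concave, so for a fixed sum of arguments the product
  is largest when all four are equal to \<open>pi / 2\<close>, where it is \<open>c\<^sup>4\<close>. Hence \<open>c \<ge> 1\<close>, that is
  \<open>a + b \<le> 1\<close>. Moreover \<open>\<alpha>\<^sub>j \<ge> 0\<close> forces \<open>t\<^sub>j \<ge> Arg z\<close>. So \<open>4 Arg z \<le> 2 pi\<close>, which is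
  \<open>a \<ge> 0\<close>; and the product is smallest when three of the arguments are equal to \<open>Arg z\<close>, that is,
  when three of the \<open>\<alpha>\<^sub>j\<close> vanish. That this smallest value is at most \<open>1\<close> is the inequality
  \<open>G a b \<ge> 0\<close>. This comparison is made for \<open>Arg z > pi / 3\<close>, where all arguments are close enough to each
  other; for \<open>Arg z \<le> pi / 3\<close> the inequality holds anyway (\<open>G_pos_if_sq_le\<close>). The identity \<open>sinusoid_mult\<close> replaces concavity: it shows directly how a product
  of two factors changes when the difference of its arguments varies and their sum is kept.

  The converse is algebraic. On \<open>G = 0\<close> the equation \<open>z\<^sup>3 (z - \<alpha>) = 1 - \<alpha>\<close> has an explicit solution
  \<open>\<alpha>\<close> (\<open>curve_eigenvalue_equation\<close>). An interior point is moved onto that curve by a dilation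
  with centre \<open>1\<close>, which corresponds to passing from \<open>B\<close> to \<open>x I + (1 - x) B\<close> for the matrices
  (\<open>interior_point_realized\<close>).
\<close>

section \<open>The characteristic equation\<close>

lemma atLeastLessThan_0_4: "{0..<4} = {0, 1, 2, 3::nat}"
  by auto

lemma cycle_mat_mult_vec:
  assumes v: "v \<in> carrier_vec 4"
  shows "map_mat complex_of_real (cycle_mat \<alpha>1 \<alpha>2 \<alpha>3 \<alpha>4) *\<^sub>v v =
    vec_of_list
      [\<alpha>1 * v $ 0 + (1 - \<alpha>1) * v $ 1, \<alpha>2 * v $ 1 + (1 - \<alpha>2) * v $ 2,
       \<alpha>3 * v $ 2 + (1 - \<alpha>3) * v $ 3, (1 - \<alpha>4) * v $ 0 + \<alpha>4 * v $ 3]"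
    (is "?l = ?r")
proof (rule eq_vecI)
  fix i
  assume "i < dim_vec ?r"
  then have "i < 4" by simp
  then consider "i = 0" | "i = 1" | "i = 2" | "i = 3" by linarith
  then show "?l $ i = ?r $ i"
    using v by cases (simp_all add: cycle_mat_def mat_of_rows_list_def scalar_prod_def atLeastLessThan_0_4
        vec_of_list_index numeral_eq_Suc)
qed (simp add: cycle_mat_def mat_of_rows_list_def)

text \<open>An eigenvector is determined by its first coordinate: each row gives the next coordinate
  as a multiple of the previous one, and the last row closes the cycle.\<close>

lemma complex_spectrum_cycle_mat_iff:
  assumes "\<alpha>1 \<noteq> 1" "\<alpha>2 \<noteq> 1" "\<alpha>3 \<noteq> 1" "\<alpha>4 \<noteq> 1"
  shows "z \<in> complex_spectrum (cycle_mat \<alpha>1 \<alpha>2 \<alpha>3 \<alpha>4) \<longleftrightarrow>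
    (z - \<alpha>1) * (z - \<alpha>2) * (z - \<alpha>3) * (z - \<alpha>4) =
    complex_of_real ((1 - \<alpha>1) * (1 - \<alpha>2) * (1 - \<alpha>3) * (1 - \<alpha>4))"
proof -
  define A where "A = map_mat complex_of_real (cycle_mat \<alpha>1 \<alpha>2 \<alpha>3 \<alpha>4)"
  have dim: "dim_row A = 4"
    by (simp add: A_def cycle_mat_def mat_of_rows_list_def)
  have ne: "complex_of_real (1 - \<alpha>1) \<noteq> 0" "complex_of_real (1 - \<alpha>2) \<noteq> 0"
    "complex_of_real (1 - \<alpha>3) \<noteq> 0"
    unfolding of_real_eq_0_iff using assms by simp_all
  have eq4: "u = w \<longleftrightarrow> u $ 0 = w $ 0 \<and> u $ 1 = w $ 1 \<and> u $ 2 = w $ 2 \<and> u $ 3 = w $ 3"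
    if "u \<in> carrier_vec 4" "w \<in> carrier_vec 4" for u w :: "complex vec"
  proof -
    have "u = w \<longleftrightarrow> (\<forall>i<4. u $ i = w $ i)"
      using that by auto
    also have "\<dots> \<longleftrightarrow> (\<forall>i\<in>{0..<4}. u $ i = w $ i)" by auto
    finally show ?thesis unfolding atLeastLessThan_0_4 by auto
  qed
  have eigen: "A *\<^sub>v v = z \<cdot>\<^sub>v v \<longleftrightarrow>
      (z - \<alpha>1) * v $ 0 = (1 - \<alpha>1) * v $ 1 \<and> (z - \<alpha>2) * v $ 1 = (1 - \<alpha>2) * v $ 2 \<and>
      (z - \<alpha>3) * v $ 2 = (1 - \<alpha>3) * v $ 3 \<and> (z - \<alpha>4) * v $ 3 = (1 - \<alpha>4) * v $ 0"
    if v: "v \<in> carrier_vec 4" for v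
  proof -
    have Av: "A *\<^sub>v v \<in> carrier_vec 4" using dim by (metis carrier_vec_dim_vec dim_mult_mat_vec)
    have zv: "z \<cdot>\<^sub>v v \<in> carrier_vec 4" using v by simp
    show ?thesis
      unfolding eq4[OF Av zv] using v unfolding A_def cycle_mat_mult_vec[OF v]
      by (auto simp: vec_of_list_index numeral_eq_Suc algebra_simps)
  qed
  have spectrum: "z \<in> complex_spectrum (cycle_mat \<alpha>1 \<alpha>2 \<alpha>3 \<alpha>4) \<longleftrightarrow>
      (\<exists>v. v \<in> carrier_vec 4 \<and> v \<noteq> 0\<^sub>v 4 \<and> A *\<^sub>v v = z \<cdot>\<^sub>v v)"
    by (simp add: complex_spectrum_def spectrum_def eigenvalue_def eigenvector_def dim
        flip: A_def)
  show ?thesis (is "_ \<longleftrightarrow> ?char")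
  proof
    assume "z \<in> complex_spectrum (cycle_mat \<alpha>1 \<alpha>2 \<alpha>3 \<alpha>4)"
    then obtain v where v: "v \<in> carrier_vec 4" "v \<noteq> 0\<^sub>v 4" "A *\<^sub>v v = z \<cdot>\<^sub>v v"
      unfolding spectrum by blast
    note e = v(3)[unfolded eigen[OF v(1)]]
    have "v $ 0 \<noteq> 0"
    proof
      assume "v $ 0 = 0"
      moreover from this have "v $ 1 = 0" using e ne by auto
      moreover from this have "v $ 2 = 0" using e ne by auto
      moreover from this have "v $ 3 = 0" using e ne by auto
      ultimately have "v = 0\<^sub>v 4" using eq4[OF v(1) zero_carrier_vec] by simp
      with v(2) show False by simp
    qed
    have telescope: "x0 * (A1 * A2 * A3 * A4) = x0 * (B1 * B2 * B3 * B4)"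
      if "A1 * x0 = B1 * x1" "A2 * x1 = B2 * x2" "A3 * x2 = B3 * x3" "A4 * x3 = B4 * x0"
      for x0 x1 x2 x3 A1 A2 A3 A4 B1 B2 B3 B4 :: complex
    proof -
      have "x0 * (A1 * A2 * A3 * A4) = (A1 * x0) * (A2 * (A3 * A4))" by (simp only: mult_ac)
      also have "\<dots> = (A2 * x1) * (B1 * (A3 * A4))" unfolding that(1) by (simp only: mult_ac)
      also have "\<dots> = (A3 * x2) * (B1 * (B2 * A4))" unfolding that(2) by (simp only: mult_ac)
      also have "\<dots> = (A4 * x3) * (B1 * (B2 * B3))" unfolding that(3) by (simp only: mult_ac)
      also have "\<dots> = x0 * (B1 * B2 * B3 * B4)" unfolding that(4) by (simp only: mult_ac)
      finally show ?thesis .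
    qed
    have "v $ 0 * ((z - \<alpha>1) * (z - \<alpha>2) * (z - \<alpha>3) * (z - \<alpha>4)) =
        v $ 0 * ((1 - \<alpha>1) * (1 - \<alpha>2) * (1 - \<alpha>3) * (1 - \<alpha>4))"
      using telescope[OF e[THEN conjunct1] e[THEN conjunct2, THEN conjunct1]
          e[THEN conjunct2, THEN conjunct2, THEN conjunct1]
          e[THEN conjunct2, THEN conjunct2, THEN conjunct2]]
      unfolding of_real_mult .
    then show ?char unfolding mult_left_cancel[OF \<open>v $ 0 \<noteq> 0\<close>] .
  next
    assume char: ?char
    define v where "v = vec_of_list
      [1, (z - \<alpha>1) / (1 - \<alpha>1), (z - \<alpha>1) * (z - \<alpha>2) / ((1 - \<alpha>1) * (1 - \<alpha>2)),
       (z - \<alpha>1) * (z - \<alpha>2) * (z - \<alpha>3) / ((1 - \<alpha>1) * (1 - \<alpha>2) * (1 - \<alpha>3))]"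
    have "dim_vec v = 4" unfolding v_def dim_vec_of_list by simp
    then have v: "v \<in> carrier_vec 4" by (rule carrier_vecI)
    have idx: "v $ 0 = 1" "v $ 1 = (z - \<alpha>1) / (1 - \<alpha>1)"
      "v $ 2 = (z - \<alpha>1) * (z - \<alpha>2) / ((1 - \<alpha>1) * (1 - \<alpha>2))"
      "v $ 3 = (z - \<alpha>1) * (z - \<alpha>2) * (z - \<alpha>3) / ((1 - \<alpha>1) * (1 - \<alpha>2) * (1 - \<alpha>3))"
      unfolding v_def vec_of_list_index by (simp_all only: nth_Cons_0 One_nat_def nth_Cons_Suc numeral_2_eq_2 numeral_3_eq_3)
    have quotients: "A1 * 1 = B1 * (A1 / B1) \<and> A2 * (A1 / B1) = B2 * (A1 * A2 / (B1 * B2)) \<and>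
        A3 * (A1 * A2 / (B1 * B2)) = B3 * (A1 * A2 * A3 / (B1 * B2 * B3)) \<and>
        A4 * (A1 * A2 * A3 / (B1 * B2 * B3)) = B4 * 1"
      if "B1 \<noteq> 0" "B2 \<noteq> 0" "B3 \<noteq> 0" "A1 * A2 * A3 * A4 = B1 * B2 * B3 * B4"
      for A1 A2 A3 A4 B1 B2 B3 B4 :: complex
      using that(1-3) that(4)[symmetric] by (simp add: mult_ac divide_simps)
    have "0\<^sub>v 4 $ 0 \<noteq> (1 :: complex)" by simp
    with idx(1) have "v \<noteq> 0\<^sub>v 4" by metis
    moreover have "A *\<^sub>v v = z \<cdot>\<^sub>v v"
      unfolding eigen[OF v] idx
      using quotients[OF ne char[unfolded of_real_mult]] unfolding of_real_mult .
    ultimately show "z \<in> complex_spectrum (cycle_mat \<alpha>1 \<alpha>2 \<alpha>3 \<alpha>4)"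
      using v unfolding spectrum by blast
  qed
qed

section \<open>The curve \<open>G = 0\<close> and the matrices \<open>A_L\<close>\<close>

lemma G_uminus [simp]: "G a (- b) = G a b"
  by (simp add: G_def)

text \<open>The points of the closed right half-plane with \<open>b > 0\<close> and \<open>G \<le> 0\<close> have argument greater than
  \<open>pi / 3\<close>.\<close>

lemma G_pos_if_sq_le:
  assumes "b > 0" "a \<ge> 0" "b\<^sup>2 \<le> 3 * a\<^sup>2"
  shows "G a b > 0"
proof (cases "b\<^sup>2 \<le> 2 * a\<^sup>2")
  case True
  have "b\<^sup>2 + a\<^sup>2 + a > 0" using assms by (simp add: add_pos_nonneg)
  then have "(b\<^sup>2 + a\<^sup>2 + a)\<^sup>2 > 0" by (rule zero_less_power)
  with True show ?thesis unfolding G_def by linarith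
next
  case False
  have "a\<^sup>2 < (b\<^sup>2 + a\<^sup>2 + a)\<^sup>2"
    using assms by (intro power_strict_mono) (auto simp: add_pos_nonneg)
  with assms(3) show ?thesis unfolding G_def by linarith
qed

text \<open>For nonreal \<open>z = a + i b\<close> with \<open>a \<ge> 0\<close> the equation \<open>z\<^sup>3 (z - \<alpha>) = 1 - \<alpha>\<close> of \<open>A_L \<alpha>\<close>
  says \<open>\<alpha> = (z\<^sup>4 - 1) / (z\<^sup>3 - 1) = z + 1 / (z\<^sup>2 + z + 1)\<close>. The right-hand side has imaginary part
  \<open>b (1 - (2 * a + 1) / \<bar>z\<^sup>2 + z + 1\<bar>\<^sup>2)\<close>, and
  \<open>\<bar>z\<^sup>2 + z + 1\<bar>\<^sup>2 - (2 * a + 1) = G a b\<close>. So on \<open>G = 0\<close> it is real, and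
  its real part is the witness below.\<close>

lemma curve_eigenvalue_equation:
  assumes "b > 0" "a \<ge> 0" "a + b \<le> 1" "G a b = 0"
  obtains \<alpha> where "0 \<le> \<alpha>" "\<alpha> < 1" "Complex a b ^ 3 * (Complex a b - of_real \<alpha>) = of_real (1 - \<alpha>)"
proof -
  define \<alpha> where "\<alpha> = a + (a\<^sup>2 - b\<^sup>2 + a + 1) / (2 * a + 1)"
  have pos: "2 * a + 1 > 0" using assms by simp
  have "b\<^sup>2 \<le> 1" using assms by (intro power_le_one) auto
  then have "a\<^sup>2 - b\<^sup>2 + a + 1 \<ge> 0" using assms zero_le_power2[of a] by linarith
  then have "\<alpha> \<ge> 0" using assms pos by (simp add: \<alpha>_def)
  have "b\<^sup>2 > 3 * a\<^sup>2" using G_pos_if_sq_le[of b a] assms by force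
  then have "\<alpha> < 1" using pos by (simp add: \<alpha>_def field_simps power2_eq_square)
  have \<alpha>: "\<alpha> * (2 * a + 1) = a * (2 * a + 1) + a\<^sup>2 - b\<^sup>2 + a + 1"
    using pos by (simp add: \<alpha>_def field_simps)
  define w where "w = Complex a b ^ 2 + Complex a b + 1"
  have w: "Re w = a\<^sup>2 - b\<^sup>2 + a + 1" "Im w = b * (2 * a + 1)"
    by (simp_all add: w_def power2_eq_square algebra_simps)
  have norm_w: "(a\<^sup>2 - b\<^sup>2 + a + 1)\<^sup>2 + b\<^sup>2 * (2 * a + 1)\<^sup>2 = 2 * a + 1"
    using assms(4) by (simp add: G_def power2_eq_square algebra_simps)
  have "(2 * a + 1) * ((a - \<alpha>) * (a\<^sup>2 - b\<^sup>2 + a + 1) - b * (b * (2 * a + 1)) + 1) = 0"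
    using \<alpha> norm_w by Groebner_Basis.algebra
  then have re: "(a - \<alpha>) * (a\<^sup>2 - b\<^sup>2 + a + 1) - b * (b * (2 * a + 1)) + 1 = 0"
    using pos by simp
  have im: "(a - \<alpha>) * (b * (2 * a + 1)) + b * (a\<^sup>2 - b\<^sup>2 + a + 1) = 0"
    using \<alpha> by Groebner_Basis.algebra
  have "(Complex a b - of_real \<alpha>) * w + 1 = 0"
    using re im by (simp add: complex_eq_iff w)
  then have "(Complex a b - 1) * ((Complex a b - of_real \<alpha>) * w + 1) = 0" by simp
  then have "Complex a b ^ 3 * (Complex a b - of_real \<alpha>) = of_real (1 - \<alpha>)"
    unfolding w_def of_real_diff of_real_1 by Groebner_Basis.algebra
  with \<open>\<alpha> \<ge> 0\<close> \<open>\<alpha> < 1\<close> that show thesis by blast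
qed

lemma C_L_plus_realized:
  assumes "z \<in> C_L_plus"
  shows "\<exists>\<alpha>\<in>{0..<1}. z \<in> complex_spectrum (cycle_mat_L \<alpha>)"
proof -
  obtain a b where z: "z = Complex a b" and ab: "b > 0" "a \<ge> 0" "a + b \<le> 1" "G a b = 0"
    using assms by (auto simp: C_L_plus_def)
  obtain \<alpha> where \<alpha>: "0 \<le> \<alpha>" "\<alpha> < 1"
    and eq: "Complex a b ^ 3 * (Complex a b - of_real \<alpha>) = of_real (1 - \<alpha>)"
    using curve_eigenvalue_equation[OF ab] by blast
  have "z \<in> complex_spectrum (cycle_mat_L \<alpha>)"
    unfolding cycle_mat_L_def using eq \<alpha>
    by (subst complex_spectrum_cycle_mat_iff) (auto simp: z power3_eq_cube mult.commute mult.left_commute)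
  with \<alpha> show ?thesis by auto
qed

lemma zero_not_in_spectrum_cycle_mat_L:
  assumes "\<alpha> \<noteq> 1"
  shows "0 \<notin> complex_spectrum (cycle_mat_L \<alpha>)"
  unfolding cycle_mat_L_def using assms
  by (subst complex_spectrum_cycle_mat_iff) auto

text \<open>Near the origin the curve is tangent to \<open>b\<^sup>2 = 3 a\<^sup>2\<close>, so for small \<open>a > 0\<close> it is caught
  between the lines \<open>b = a\<close>, where \<open>G > 0\<close>, and \<open>b = 2 a\<close>, where \<open>G < 0\<close>.\<close>

lemma zero_islimpt_C_L_plus: "0 islimpt C_L_plus"
  unfolding islimpt_approachable
proof (intro allI impI)
  fix e :: real assume "e > 0"
  define a where "a = min (e / 4) (1 / 20)"
  have a: "a > 0" "a \<le> 1 / 20" "4 * a \<le> e" using \<open>e > 0\<close> by (auto simp: a_def)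
  have "(1 + 5 * a)\<^sup>2 \<le> (5 / 4)\<^sup>2" using a by (intro power_mono) auto
  then have "a\<^sup>2 * ((1 + 5 * a)\<^sup>2 - 2) \<le> 0"
    by (intro mult_nonneg_nonpos) (auto simp: power2_eq_square)
  then have "G a (2 * a) \<le> 0"
    by (simp add: G_def power2_eq_square algebra_simps)
  moreover have "G a a \<ge> 0" by (simp add: G_def)
  moreover have "continuous_on {a..2 * a} (G a)"
    unfolding G_def by (intro continuous_intros)
  ultimately obtain b where b: "a \<le> b" "b \<le> 2 * a" "G a b = 0"
    using IVT2'[of "G a" "2 * a" 0 a] a by auto
  have "Complex a b \<in> C_L_plus" using a b by (auto simp: C_L_plus_def)
  moreover have "Complex a b \<noteq> 0" using a by (simp add: complex_eq_iff)
  moreover have "dist (Complex a b) 0 < e"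
    using cmod_le[of "Complex a b"] a b by simp
  ultimately show "\<exists>z\<in>C_L_plus. z \<noteq> 0 \<and> dist z 0 < e" by blast
qed

section \<open>Interior points\<close>

text \<open>Since \<open>A(x, x, x, x + (1 - x) \<gamma>) = x I + (1 - x) A_L \<gamma>\<close>, it suffices to move the given
  point away from \<open>1\<close>, on the ray from \<open>1\<close> through it, until it meets the curve: \<open>(z - x) / (1 - x)\<close> starts at \<open>z\<close>, where \<open>G > 0\<close>,
  and reaches for \<open>x = a\<close> the point \<open>i s\<close> with \<open>s = b / (1 - a) < 1\<close>, where \<open>G = s\<^sup>4 - s\<^sup>2 < 0\<close>.\<close>

lemma interior_point_realized:
  assumes "b > 0" "0 \<le> a" "a + b < 1" "G a b > 0"
  shows "\<exists>\<alpha>1\<in>{0..<1}. \<exists>\<alpha>2\<in>{0..<1}. \<exists>\<alpha>3\<in>{0..<1}. \<exists>\<alpha>4\<in>{0..<1}.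
    Complex a b \<in> complex_spectrum (cycle_mat \<alpha>1 \<alpha>2 \<alpha>3 \<alpha>4)"
proof -
  define F where "F x = G ((a - x) / (1 - x)) (b / (1 - x))" for x
  define s where "s = b / (1 - a)"
  have s: "0 < s" "s < 1" using assms by (auto simp: s_def)
  have "F a = s\<^sup>2 * (s\<^sup>2 - 1)"
    by (simp add: F_def G_def s_def power2_eq_square algebra_simps)
  also have "\<dots> \<le> 0"
    using s by (intro mult_nonneg_nonpos) (auto simp: power_le_one)
  finally have "F a \<le> 0" .
  moreover have "F 0 \<ge> 0" using assms by (simp add: F_def)
  moreover have "continuous_on {0..a} F"
    unfolding F_def G_def using assms by (intro continuous_intros) auto
  ultimately obtain x where x: "0 \<le> x" "x \<le> a" "F x = 0"
    using IVT2'[of F a 0 0] assms by auto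
  have x1: "1 - x > 0" using x assms by simp
  define p q where "p = (a - x) / (1 - x)" and "q = b / (1 - x)"
  have "q > 0" "p \<ge> 0" "p + q \<le> 1" "G p q = 0"
    using x x1 assms by (auto simp: p_def q_def F_def simp flip: add_divide_distrib)
  then obtain \<gamma> where \<gamma>: "0 \<le> \<gamma>" "\<gamma> < 1"
    and eq: "Complex p q ^ 3 * (Complex p q - of_real \<gamma>) = of_real (1 - \<gamma>)"
    using curve_eigenvalue_equation by blast
  define \<beta> where "\<beta> = x + (1 - x) * \<gamma>"
  have \<beta>: "1 - \<beta> = (1 - x) * (1 - \<gamma>)" by (simp add: \<beta>_def algebra_simps)
  moreover have "(1 - x) * (1 - \<gamma>) > 0" using x1 \<gamma> by simp
  ultimately have "\<beta> < 1" by linarith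
  have "\<beta> \<ge> 0" using x x1 \<gamma> by (simp add: \<beta>_def)
  have shift: "Complex a b - of_real x = of_real (1 - x) * Complex p q"
    using x1 by (simp add: complex_eq_iff p_def q_def)
  have shift': "Complex a b - of_real \<beta> = of_real (1 - x) * (Complex p q - of_real \<gamma>)"
    using shift by (simp add: \<beta>_def algebra_simps)
  have "(Complex a b - x) * (Complex a b - x) * (Complex a b - x) * (Complex a b - \<beta>) =
      of_real (1 - x) ^ 4 * (Complex p q ^ 3 * (Complex p q - of_real \<gamma>))"
    unfolding shift shift' by (simp add: eval_nat_numeral mult_ac)
  also have "\<dots> = of_real ((1 - x) * (1 - x) * (1 - x) * (1 - \<beta>))"
    unfolding eq \<beta> by (simp add: eval_nat_numeral mult_ac)
  finally have "Complex a b \<in> complex_spectrum (cycle_mat x x x \<beta>)"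
    using x1 \<open>\<beta> < 1\<close> by (subst complex_spectrum_cycle_mat_iff) auto
  with x x1 \<open>\<beta> < 1\<close> \<open>\<beta> \<ge> 0\<close> show ?thesis
    by (intro bexI[of _ x] bexI[of _ \<beta>]) auto
qed

text \<open>The matrix is real, so its spectrum is symmetric about the real axis.\<close>

lemma complex_spectrum_cycle_mat_cnj:
  assumes "\<alpha>1 \<noteq> 1" "\<alpha>2 \<noteq> 1" "\<alpha>3 \<noteq> 1" "\<alpha>4 \<noteq> 1"
    and "Complex a b \<in> complex_spectrum (cycle_mat \<alpha>1 \<alpha>2 \<alpha>3 \<alpha>4)"
  shows "Complex a (- b) \<in> complex_spectrum (cycle_mat \<alpha>1 \<alpha>2 \<alpha>3 \<alpha>4)"
proof -
  have "cnj ((Complex a b - \<alpha>1) * (Complex a b - \<alpha>2) * (Complex a b - \<alpha>3) * (Complex a b - \<alpha>4)) =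
      cnj (of_real ((1 - \<alpha>1) * (1 - \<alpha>2) * (1 - \<alpha>3) * (1 - \<alpha>4)))"
    using complex_spectrum_cycle_mat_iff[THEN iffD1, OF assms] by (rule arg_cong)
  moreover have "cnj (Complex a b) = Complex a (- b)" by (simp add: complex_eq_iff)
  ultimately show ?thesis
    using assms by (subst complex_spectrum_cycle_mat_iff) auto
qed

section \<open>Products of sinusoids with a prescribed sum of arguments\<close>

text \<open>If \<open>t\<close> is the argument of \<open>z - \<alpha>\<close>, where \<open>z = a + i b\<close> with \<open>b > 0\<close>, then
  \<open>(1 - \<alpha>) / \<bar>z - \<alpha>\<bar> = sinusoid c t\<close> for \<open>c = (1 - a) / b\<close>.\<close>

definition sinusoid :: "real \<Rightarrow> real \<Rightarrow> real" where
  "sinusoid c t = cos t + c * sin t"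

lemma sinusoid_mult:
  "2 * (sinusoid c x * sinusoid c y) =
     (1 + c\<^sup>2) * cos (x - y) + (1 - c\<^sup>2) * cos (x + y) + 2 * c * sin (x + y)"
  by (simp add: sinusoid_def cos_diff cos_add sin_add power2_eq_square algebra_simps)

text \<open>For a fixed sum of the arguments the product depends only on the cosine of their difference.\<close>

lemma sinusoid_mult_mono:
  assumes "x + y = u + v" "\<bar>x - y\<bar> \<le> \<bar>u - v\<bar>" "\<bar>u - v\<bar> \<le> pi"
  shows "sinusoid c u * sinusoid c v \<le> sinusoid c x * sinusoid c y"
proof -
  have "cos \<bar>u - v\<bar> \<le> cos \<bar>x - y\<bar>"
    using assms by (subst cos_mono_le_eq) auto
  then have "(1 + c\<^sup>2) * cos (u - v) \<le> (1 + c\<^sup>2) * cos (x - y)"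
    by (intro mult_left_mono) auto
  then show ?thesis
    using sinusoid_mult[of c x y] sinusoid_mult[of c u v] assms(1) by simp
qed

lemma sinusoid_midpoint_pos:
  assumes "sinusoid c x > 0" "sinusoid c y > 0" "\<bar>x - y\<bar> < pi"
  shows "sinusoid c ((x + y) / 2) > 0"
proof -
  define m d where "m = (x + y) / 2" and "d = (x - y) / 2"
  have xy: "x = m + d" "y = m - d" by (auto simp: m_def d_def field_simps)
  have "cos d > 0" using assms(3) by (intro cos_gt_zero_pi) (auto simp: d_def)
  moreover have "sinusoid c x + sinusoid c y = 2 * cos d * sinusoid c m"
    by (simp add: xy sinusoid_def cos_add sin_add cos_diff sin_diff algebra_simps)
  ultimately show ?thesis
    using assms(1,2) by (fold m_def) (metis add_pos_pos mult_pos_pos zero_less_mult_pos zero_less_numeral)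
qed

text \<open>Equalizing two arguments with their sum fixed increases the product. Doing this within two
  pairs and then between their midpoints leads to four arguments \<open>pi / 2\<close>, where the sinusoid
  takes the value \<open>c\<close>.\<close>

lemma sinusoid_prod_eq_1_imp_ge_1:
  assumes range: "x \<in> {0<..<pi}" "y \<in> {0<..<pi}" "z \<in> {0<..<pi}" "w \<in> {0<..<pi}"
    and sum: "x + y + z + w = 2 * pi"
    and pos: "sinusoid c x > 0" "sinusoid c y > 0" "sinusoid c z > 0" "sinusoid c w > 0"
    and prod: "sinusoid c x * sinusoid c y * sinusoid c z * sinusoid c w = 1"
  shows "c \<ge> 1"
proof -
  define m n where "m = (x + y) / 2" and "n = (z + w) / 2"
  have "m + n = pi" using sum by (simp add: m_def n_def add.assoc flip: add_divide_distrib)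
  then have mn: "0 < m" "m < pi" "0 < n" "n < pi" "(m + n) / 2 = pi / 2" "m + n = pi / 2 + pi / 2"
    using range by (auto simp: m_def n_def)
  have gm: "sinusoid c m > 0" unfolding m_def
    by (rule sinusoid_midpoint_pos) (use pos range in \<open>auto simp: abs_less_iff\<close>)
  have gn: "sinusoid c n > 0" unfolding n_def
    by (rule sinusoid_midpoint_pos) (use pos range in \<open>auto simp: abs_less_iff\<close>)
  have half: "sinusoid c (pi / 2) = c" by (simp add: sinusoid_def)
  have "\<bar>m - n\<bar> < pi" using mn(1-4) by (simp add: abs_less_iff)
  from sinusoid_midpoint_pos[OF gm gn this] have "c > 0" unfolding mn(5) half .
  have mid: "sinusoid c s * sinusoid c t \<le> sinusoid c r * sinusoid c r" if "s + t = r + r" for s t r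
  proof -
    have "(1 + c\<^sup>2) * cos (s - t) \<le> (1 + c\<^sup>2) * 1" by (intro mult_left_mono) auto
    then show ?thesis
      using sinusoid_mult[of c s t] sinusoid_mult[of c r r] that by simp
  qed
  have "1 = (sinusoid c x * sinusoid c y) * (sinusoid c z * sinusoid c w)"
    using prod by (simp add: mult.assoc)
  also have "\<dots> \<le> (sinusoid c m * sinusoid c m) * (sinusoid c n * sinusoid c n)"
    using pos by (intro mult_mono mid) (auto simp: m_def n_def)
  also have "\<dots> = (sinusoid c m * sinusoid c n)\<^sup>2" by (simp add: power2_eq_square)
  also have "\<dots> \<le> (c * c)\<^sup>2"
    using gm gn mid[OF mn(6)] half by (intro power_mono) auto
  also have "\<dots> = c ^ 4" by (simp add: eval_nat_numeral)
  finally show ?thesis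
    using \<open>c > 0\<close> by (metis less_le_not_le linorder_not_le power_less_one_iff zero_less_numeral less_eq_real_def)
qed

text \<open>Spreading two arguments decreases the product. With \<open>t\<close> as lower bound for
  all of them, three steps move three of the arguments to \<open>t\<close>. The
  differences that occur are at most \<open>x + y + z + w - 4 * t\<close>, so the bound by \<open>pi\<close> keeps them where
  cosine is decreasing.\<close>

lemma sinusoid_prod_ge_extreme:
  assumes lower: "t \<le> x" "t \<le> y" "t \<le> z" "t \<le> w"
    and sum: "x + y + z + w - 4 * t \<le> pi"
    and pos: "sinusoid c z > 0" "sinusoid c w > 0" "sinusoid c t > 0"
  shows "sinusoid c t ^ 3 * sinusoid c (x + y + z + w - 3 * t) \<le>
    sinusoid c x * sinusoid c y * sinusoid c z * sinusoid c w"
proof -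
  define s where "s = x + y - t"
  define r where "r = s + z - t"
  have e: "x + y + z + w - 3 * t = r + w - t" by (simp add: s_def r_def)
  have "sinusoid c t * sinusoid c (r + w - t) \<le> sinusoid c r * sinusoid c w"
    using lower sum by (intro sinusoid_mult_mono) (auto simp: s_def r_def)
  then have "sinusoid c t ^ 2 * (sinusoid c t * sinusoid c (r + w - t)) \<le>
      sinusoid c t ^ 2 * (sinusoid c r * sinusoid c w)"
    by (intro mult_left_mono) auto
  also have "\<dots> = sinusoid c t * sinusoid c w * (sinusoid c t * sinusoid c r)"
    by (simp add: power2_eq_square)
  also have "\<dots> \<le> sinusoid c t * sinusoid c w * (sinusoid c s * sinusoid c z)"
    using pos lower sum by (intro mult_left_mono sinusoid_mult_mono) (auto simp: s_def r_def)
  also have "\<dots> = sinusoid c w * sinusoid c z * (sinusoid c t * sinusoid c s)"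
    by simp
  also have "\<dots> \<le> sinusoid c w * sinusoid c z * (sinusoid c x * sinusoid c y)"
    using pos lower sum by (intro mult_left_mono sinusoid_mult_mono) (auto simp: s_def)
  finally show ?thesis unfolding e by (simp add: power2_eq_square power3_eq_cube mult_ac)
qed

section \<open>Necessary conditions\<close>

lemma Arg_Im_pos:
  assumes "Im u > 0"
  shows "Arg u \<in> {0<..<pi}" "u = of_real (cmod u) * cis (Arg u)" "cmod u > 0"
proof -
  have "u \<noteq> 0" using assms by auto
  then show "cmod u > 0" by simp
  show "u = of_real (cmod u) * cis (Arg u)"
    using rcis_cmod_Arg[of u] by (simp add: rcis_def)
  have sin: "sin (Arg u) > 0" using assms \<open>u \<noteq> 0\<close> by (simp add: sin_Arg)
  then have "\<not> 0 \<le> - Arg u" "Arg u \<noteq> pi"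
    using sin_ge_zero[of "- Arg u"] Arg_bounded[of u] by auto
  then show "Arg u \<in> {0<..<pi}" using Arg_bounded[of u] by auto
qed

lemma one_minus_eq_norm_mult_sinusoid:
  assumes "b > 0"
  shows "1 - \<alpha> = cmod (Complex a b - of_real \<alpha>) *
    sinusoid ((1 - a) / b) (Arg (Complex a b - of_real \<alpha>))"
proof -
  define u where "u = Complex a b - of_real \<alpha>"
  have "Im u > 0" using assms by (simp add: u_def)
  note u = Arg_Im_pos[OF this]
  have re: "a - \<alpha> = cmod u * cos (Arg u)"
    using arg_cong[OF u(2), of Re] by (simp add: u_def)
  have im: "b = cmod u * sin (Arg u)"
    using arg_cong[OF u(2), of Im] by (simp add: u_def)
  have "cmod u * sinusoid ((1 - a) / b) (Arg u) =
      cmod u * cos (Arg u) + (1 - a) / b * (cmod u * sin (Arg u))"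
    by (simp add: sinusoid_def algebra_simps)
  also have "\<dots> = 1 - \<alpha>" using assms unfolding re[symmetric] im[symmetric] by simp
  finally show ?thesis by (simp add: u_def)
qed

text \<open>The sign of \<open>sin (Arg (z - \<alpha>) - Arg z)\<close> is that of \<open>Im ((z - \<alpha>) * cnj z) = \<alpha> * b\<close>.\<close>

lemma Arg_diff_nonneg_real:
  assumes "b > 0" "\<alpha> \<ge> 0"
  shows "Arg (Complex a b) \<le> Arg (Complex a b - of_real \<alpha>)"
proof -
  define z u where "z = Complex a b" and "u = Complex a b - of_real \<alpha>"
  have pos: "Im z > 0" "Im u > 0" using assms by (auto simp: z_def u_def)
  note z = Arg_Im_pos[OF pos(1)] and u = Arg_Im_pos[OF pos(2)]
  have zz: "a = cmod z * cos (Arg z)" "b = cmod z * sin (Arg z)"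
    using arg_cong[OF z(2), of Re] arg_cong[OF z(2), of Im] by (simp_all add: z_def)
  have uu: "a - \<alpha> = cmod u * cos (Arg u)" "b = cmod u * sin (Arg u)"
    using arg_cong[OF u(2), of Re] arg_cong[OF u(2), of Im] by (simp_all add: u_def)
  have "cmod u * cmod z * sin (Arg u - Arg z) =
      (cmod u * sin (Arg u)) * (cmod z * cos (Arg z)) - (cmod u * cos (Arg u)) * (cmod z * sin (Arg z))"
    by (simp add: sin_diff algebra_simps)
  also have "\<dots> = b * a - (a - \<alpha>) * b"
    using zz uu by simp
  also have "\<dots> = \<alpha> * b" by (simp add: algebra_simps)
  also have "\<dots> \<ge> 0" using assms by simp
  finally have "0 \<le> cmod u * cmod z * sin (Arg u - Arg z)" .
  moreover have "cmod u * cmod z > 0" using z(3) u(3) by simp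
  ultimately have "sin (Arg u - Arg z) \<ge> 0" by (metis zero_le_mult_iff not_le)
  have "\<not> Arg u < Arg z"
  proof
    assume "Arg u < Arg z"
    then have "sin (Arg z - Arg u) > 0"
      using z(1) u(1) by (intro sin_gt_zero) auto
    with \<open>sin (Arg u - Arg z) \<ge> 0\<close> show False by (simp add: sin_diff mult.commute)
  qed
  then show ?thesis by (simp add: z_def u_def)
qed

text \<open>The argument of a positive real number is a multiple of \<open>2 pi\<close>, and the only one strictly
  between \<open>0\<close> and \<open>4 pi\<close> is \<open>2 pi\<close>.\<close>

lemma cis_eq_pos_real:
  assumes "cis s = of_real r" "r > 0" "0 < s" "s < 4 * pi"
  shows "s = 2 * pi" "r = 1"
proof -
  have "norm (cis s) = norm (complex_of_real r)" using assms(1) by simp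
  then show "r = 1" using assms(2) by simp
  with assms(1) have "cis s = 1" by simp
  then have "cos s = 1" by (metis cis.simps(1) one_complex.simps(1))
  then obtain n :: int where n: "s = of_int n * 2 * pi" using cos_one_2pi_int by auto
  have "0 < of_int n * (2 * pi)" "of_int n * (2 * pi) < 2 * (2 * pi)" using assms n by auto
  then have "0 < real_of_int n" "real_of_int n < 2"
    by (auto simp: zero_less_mult_iff)
  then have "n = 1" by linarith
  with n show "s = 2 * pi" by simp
qed

text \<open>The characteristic equation, divided by the product of the moduli of the \<open>z - \<alpha>\<close>, equates a
  point of the unit circle with a positive real number.\<close>

lemma characteristic_equation_polar:
  assumes b: "b > 0" and \<alpha>: "\<alpha>1 < 1" "\<alpha>2 < 1" "\<alpha>3 < 1" "\<alpha>4 < 1"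
    and char: "(Complex a b - \<alpha>1) * (Complex a b - \<alpha>2) * (Complex a b - \<alpha>3) * (Complex a b - \<alpha>4) =
      complex_of_real ((1 - \<alpha>1) * (1 - \<alpha>2) * (1 - \<alpha>3) * (1 - \<alpha>4))"
  defines "t \<equiv> \<lambda>\<alpha>. Arg (Complex a b - complex_of_real \<alpha>)"
  defines "g \<equiv> \<lambda>\<alpha>. sinusoid ((1 - a) / b) (t \<alpha>)"
  shows "t \<alpha>1 + t \<alpha>2 + t \<alpha>3 + t \<alpha>4 = 2 * pi" "g \<alpha>1 * g \<alpha>2 * g \<alpha>3 * g \<alpha>4 = 1"
    and "g \<alpha>1 > 0" "g \<alpha>2 > 0" "g \<alpha>3 > 0" "g \<alpha>4 > 0"
proof -
  define R where "R \<alpha> = cmod (Complex a b - complex_of_real \<alpha>)" for \<alpha>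
  have im: "Im (Complex a b - complex_of_real \<alpha>) > 0" for \<alpha> using b by simp
  have t: "t \<alpha> \<in> {0<..<pi}" "Complex a b - \<alpha> = of_real (R \<alpha>) * cis (t \<alpha>)" "R \<alpha> > 0" for \<alpha>
    unfolding t_def R_def using Arg_Im_pos[OF im, of \<alpha>] by auto
  have g: "1 - \<alpha> = R \<alpha> * g \<alpha>" for \<alpha>
    unfolding R_def g_def t_def by (rule one_minus_eq_norm_mult_sinusoid[OF b])
  have pos: "g \<alpha> > 0" if "\<alpha> < 1" for \<alpha>
    using that g[of \<alpha>] t(3)[of \<alpha>] by (metis diff_gt_0_iff_gt zero_less_mult_pos)
  show pos4: "g \<alpha>1 > 0" "g \<alpha>2 > 0" "g \<alpha>3 > 0" "g \<alpha>4 > 0" using pos \<alpha> by auto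
  define N where "N = complex_of_real (R \<alpha>1 * R \<alpha>2 * R \<alpha>3 * R \<alpha>4)"
  have "N \<noteq> 0" unfolding N_def using t(3) by (simp add: less_imp_neq[symmetric])
  have "N * cis (t \<alpha>1 + t \<alpha>2 + t \<alpha>3 + t \<alpha>4) = N * of_real (g \<alpha>1 * g \<alpha>2 * g \<alpha>3 * g \<alpha>4)"
    using char unfolding t(2) g N_def by (simp add: mult_ac flip: cis_mult)
  then have cis: "cis (t \<alpha>1 + t \<alpha>2 + t \<alpha>3 + t \<alpha>4) = of_real (g \<alpha>1 * g \<alpha>2 * g \<alpha>3 * g \<alpha>4)"
    using \<open>N \<noteq> 0\<close> by (metis mult_left_cancel)
  have "g \<alpha>1 * g \<alpha>2 * g \<alpha>3 * g \<alpha>4 > 0" using pos4 by simp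
  moreover have "0 < t \<alpha>1 + t \<alpha>2 + t \<alpha>3 + t \<alpha>4" "t \<alpha>1 + t \<alpha>2 + t \<alpha>3 + t \<alpha>4 < 4 * pi"
    using t(1)[of \<alpha>1] t(1)[of \<alpha>2] t(1)[of \<alpha>3] t(1)[of \<alpha>4] by auto
  ultimately show "t \<alpha>1 + t \<alpha>2 + t \<alpha>3 + t \<alpha>4 = 2 * pi" "g \<alpha>1 * g \<alpha>2 * g \<alpha>3 * g \<alpha>4 = 1"
    using cis_eq_pos_real[OF cis] by auto
qed

text \<open>If \<open>P\<close> is the product on the left-hand side, which belongs to three \<open>\<alpha>\<close>'s equal to \<open>0\<close>, then
  \<open>\<bar>z\<bar>\<^sup>6 * b * (1 - P) = b * \<bar>z - 1\<bar>\<^sup>2 * G a b\<close>, because the first factor is \<open>1 / \<bar>z\<bar>\<^sup>3\<close> and the second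
  one is a combination of the real and imaginary parts of \<open>z\<^sup>3 / \<bar>z\<bar>\<^sup>3\<close>.\<close>

lemma G_nonneg_if_extreme_le_1:
  assumes b: "b > 0"
    and le: "sinusoid ((1 - a) / b) (Arg (Complex a b)) ^ 3 *
      sinusoid ((1 - a) / b) (2 * pi - 3 * Arg (Complex a b)) \<le> 1"
  shows "G a b \<ge> 0"
proof -
  define z t \<rho> c where "z = Complex a b" and "t = Arg z" and "\<rho> = cmod z" and "c = (1 - a) / b"
  have "Im z > 0" using b by (simp add: z_def)
  note z = Arg_Im_pos[OF this, folded t_def \<rho>_def]
  have re: "\<rho> * cos t = a" and im: "\<rho> * sin t = b"
    using arg_cong[OF z(2), of Re] arg_cong[OF z(2), of Im] by (simp_all add: z_def)
  have bc: "b * c = 1 - a" using b by (simp add: c_def)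
  have \<rho>2: "\<rho>\<^sup>2 = a\<^sup>2 + b\<^sup>2" by (simp add: \<rho>_def z_def cmod_def)
  have g0: "\<rho> * sinusoid c t = 1"
    using one_minus_eq_norm_mult_sinusoid[OF b, of 0 a] by (simp add: \<rho>_def t_def c_def z_def)
  have "z ^ 3 = of_real (\<rho> ^ 3) * cis (3 * t)"
    by (subst z(2)) (simp add: power_mult_distrib Complex.DeMoivre)
  then have "Re (z ^ 3) = \<rho> ^ 3 * cos (3 * t)" "Im (z ^ 3) = \<rho> ^ 3 * sin (3 * t)"
    by simp_all
  then have cube: "\<rho> ^ 3 * cos (3 * t) = a ^ 3 - 3 * a * b\<^sup>2" "\<rho> ^ 3 * sin (3 * t) = 3 * a\<^sup>2 * b - b ^ 3"
    by (simp_all add: z_def power3_eq_cube power2_eq_square algebra_simps)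
  have g3: "sinusoid c (2 * pi - 3 * t) = cos (3 * t) - c * sin (3 * t)"
    by (simp add: sinusoid_def cos_diff sin_diff)
  have "\<rho> ^ 6 * b * (sinusoid c t ^ 3 * sinusoid c (2 * pi - 3 * t)) \<le> \<rho> ^ 6 * b * 1"
    using le b unfolding t_def c_def z_def by (intro mult_left_mono) auto
  also have "\<rho> ^ 6 * b * (sinusoid c t ^ 3 * sinusoid c (2 * pi - 3 * t)) =
      (\<rho> * sinusoid c t) ^ 3 * (b * (\<rho> ^ 3 * cos (3 * t)) - (b * c) * (\<rho> ^ 3 * sin (3 * t)))"
    unfolding g3 by Groebner_Basis.algebra
  also have "\<dots> = b * (a ^ 3 - 3 * a * b\<^sup>2) - (1 - a) * (3 * a\<^sup>2 * b - b ^ 3)"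
    unfolding g0 cube bc by simp
  finally have "0 \<le> (\<rho>\<^sup>2) ^ 3 * b - (b * (a ^ 3 - 3 * a * b\<^sup>2) - (1 - a) * (3 * a\<^sup>2 * b - b ^ 3))"
    by simp
  also have "\<dots> = b * ((a - 1)\<^sup>2 + b\<^sup>2) * G a b"
    unfolding G_def \<rho>2 by Groebner_Basis.algebra
  finally have "0 \<le> b * ((a - 1)\<^sup>2 + b\<^sup>2) * G a b" .
  moreover have "b * ((a - 1)\<^sup>2 + b\<^sup>2) > 0"
    using b by (intro mult_pos_pos add_nonneg_pos) auto
  ultimately show ?thesis by (metis zero_le_mult_iff not_le)
qed

lemma upper_eigenvalue_conditions:
  assumes b: "b > 0" and \<alpha>: "\<alpha>1 \<in> {0..<1}" "\<alpha>2 \<in> {0..<1}" "\<alpha>3 \<in> {0..<1}" "\<alpha>4 \<in> {0..<1}"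
    and spec: "Complex a b \<in> complex_spectrum (cycle_mat \<alpha>1 \<alpha>2 \<alpha>3 \<alpha>4)"
  shows "0 \<le> a" "a + b \<le> 1" "G a b \<ge> 0"
proof -
  define c where "c = (1 - a) / b"
  define t where "t \<alpha> = Arg (Complex a b - complex_of_real \<alpha>)" for \<alpha>
  define z where "z = Complex a b"
  define t0 where "t0 = Arg z"
  have char: "(Complex a b - \<alpha>1) * (Complex a b - \<alpha>2) * (Complex a b - \<alpha>3) * (Complex a b - \<alpha>4) =
      complex_of_real ((1 - \<alpha>1) * (1 - \<alpha>2) * (1 - \<alpha>3) * (1 - \<alpha>4))"
    using spec \<alpha> by (subst (asm) complex_spectrum_cycle_mat_iff) auto
  have \<alpha>lt: "\<alpha>1 < 1" "\<alpha>2 < 1" "\<alpha>3 < 1" "\<alpha>4 < 1" using \<alpha> by auto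
  note polar = characteristic_equation_polar[OF b \<alpha>lt char, folded t_def c_def]
  have range: "t \<alpha> \<in> {0<..<pi}" for \<alpha>
    unfolding t_def using b by (intro Arg_Im_pos) auto
  have "Im z > 0" using b by (simp add: z_def)
  note z = Arg_Im_pos[OF this, folded t0_def]
  have re: "cmod z * cos t0 = a"
    using arg_cong[OF z(2), of Re] by (simp add: z_def)
  have lower: "t0 \<le> t \<alpha>" if "\<alpha> \<ge> 0" for \<alpha>
    unfolding t0_def t_def z_def using Arg_diff_nonneg_real[OF b that] .
  have lower4: "t0 \<le> t \<alpha>1" "t0 \<le> t \<alpha>2" "t0 \<le> t \<alpha>3" "t0 \<le> t \<alpha>4"
    using \<alpha> lower by auto
  have "t0 \<le> pi / 2" using lower4 polar(1) by linarith
  then have "cos t0 \<ge> 0" using z(1) by (intro cos_ge_zero) auto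
  then show a: "0 \<le> a" unfolding re[symmetric] by simp
  have "c \<ge> 1"
    using polar range by (intro sinusoid_prod_eq_1_imp_ge_1[of "t \<alpha>1" "t \<alpha>2" "t \<alpha>3" "t \<alpha>4"])
  then show "a + b \<le> 1" using b by (simp add: c_def field_simps)
  show "G a b \<ge> 0"
  proof (cases "b\<^sup>2 \<le> 3 * a\<^sup>2")
    case True
    then show ?thesis using G_pos_if_sq_le[OF b a] by simp
  next
    case False
    have "(2 * a)\<^sup>2 < (cmod z)\<^sup>2" using False by (simp add: z_def cmod_def)
    then have "2 * a < cmod z" by (rule power_less_imp_less_base) simp
    then have "cmod z * cos t0 < cmod z * (1 / 2)" unfolding re by simp
    then have "cos t0 < cos (pi / 3)" using z(3) by (simp add: cos_60)
    then have "t0 > pi / 3" using z(1) by (subst (asm) cos_mono_less_eq) auto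
    \<comment> \<open>the sum of the arguments is \<open>2 pi\<close>, so it exceeds \<open>4 * t0\<close> by less than \<open>2 pi / 3\<close>\<close>
    then have "t \<alpha>1 + t \<alpha>2 + t \<alpha>3 + t \<alpha>4 - 4 * t0 \<le> pi" using polar(1) z(1) by simp
    moreover have "sinusoid c t0 > 0"
    proof (rule zero_less_mult_pos[OF _ z(3)])
      show "0 < cmod z * sinusoid c t0"
        using one_minus_eq_norm_mult_sinusoid[OF b, of 0 a] by (simp add: t0_def c_def z_def)
    qed
    ultimately have "sinusoid c t0 ^ 3 * sinusoid c (2 * pi - 3 * t0) \<le> 1"
      using sinusoid_prod_ge_extreme[OF lower4, of c] polar by simp
    then show ?thesis
      unfolding c_def t0_def z_def by (rule G_nonneg_if_extreme_le_1[OF b])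
  qed
qed

lemma eigenvalue_conditions:
  assumes b: "b \<noteq> 0" and \<alpha>: "\<alpha>1 \<in> {0..<1}" "\<alpha>2 \<in> {0..<1}" "\<alpha>3 \<in> {0..<1}" "\<alpha>4 \<in> {0..<1}"
    and spec: "Complex a b \<in> complex_spectrum (cycle_mat \<alpha>1 \<alpha>2 \<alpha>3 \<alpha>4)"
  shows "(0 \<le> a \<and> a < 1) \<and> a + \<bar>b\<bar> \<le> 1 \<and> G a b \<ge> 0"
proof (cases "b > 0")
  case True
  show ?thesis using upper_eigenvalue_conditions[OF True \<alpha> spec] True by auto
next
  case False
  then have "- b > 0" using b by simp
  moreover have "Complex a (- b) \<in> complex_spectrum (cycle_mat \<alpha>1 \<alpha>2 \<alpha>3 \<alpha>4)"
    using \<alpha> spec by (intro complex_spectrum_cycle_mat_cnj) auto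
  ultimately show ?thesis using upper_eigenvalue_conditions[OF _ \<alpha>] by fastforce
qed

theorem theorem3p5:
  shows
    "\<comment> \<open>necessity\<close>
     (\<forall>\<alpha>1\<in>{0..<1}. \<forall>\<alpha>2\<in>{0..<1}. \<forall>\<alpha>3\<in>{0..<1}. \<forall>\<alpha>4\<in>{0..<1}. \<forall>a b :: real.
        Complex a b \<in> complex_spectrum (cycle_mat \<alpha>1 \<alpha>2 \<alpha>3 \<alpha>4) \<and> b \<noteq> 0 \<longrightarrow>
          (0 \<le> a \<and> a < 1) \<and> a + \<bar>b\<bar> \<le> 1 \<and> G a b \<ge> 0) \<and>
     \<comment> \<open>converse, upper and lower half-plane\<close>
     (\<forall>a b :: real. b > 0 \<and> 0 \<le> a \<and> a < 1 \<and> a + b < 1 \<and> G a b > 0 \<longrightarrow>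
        (\<exists>\<alpha>1\<in>{0..<1}. \<exists>\<alpha>2\<in>{0..<1}. \<exists>\<alpha>3\<in>{0..<1}. \<exists>\<alpha>4\<in>{0..<1}.
           Complex a b \<in> complex_spectrum (cycle_mat \<alpha>1 \<alpha>2 \<alpha>3 \<alpha>4))) \<and>
     (\<forall>a b :: real. b < 0 \<and> 0 \<le> a \<and> a < 1 \<and> a + \<bar>b\<bar> < 1 \<and> G a b > 0 \<longrightarrow>
        (\<exists>\<alpha>1\<in>{0..<1}. \<exists>\<alpha>2\<in>{0..<1}. \<exists>\<alpha>3\<in>{0..<1}. \<exists>\<alpha>4\<in>{0..<1}.
           Complex a b \<in> complex_spectrum (cycle_mat \<alpha>1 \<alpha>2 \<alpha>3 \<alpha>4))) \<and>
     \<comment> \<open>boundary, part (i)\<close>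
     (\<forall>x\<in>{0<..1 :: real}.
        Complex (1 - x) x \<in> complex_spectrum (cycle_mat (1 - x) (1 - x) (1 - x) (1 - x))) \<and>
     (\<exists>\<alpha>1\<in>{0..<1}. \<exists>\<alpha>2\<in>{0..<1}. \<exists>\<alpha>3\<in>{0..<1}. \<exists>\<alpha>4\<in>{0..<1}.
        1 \<in> complex_spectrum (cycle_mat \<alpha>1 \<alpha>2 \<alpha>3 \<alpha>4)) \<and>
     \<comment> \<open>boundary, part (ii)\<close>
     (\<forall>z\<in>C_L_plus. \<exists>\<alpha>\<in>{0..<1}. z \<in> complex_spectrum (cycle_mat_L \<alpha>)) \<and>
     (\<forall>\<alpha>\<in>{0..<1}. 0 \<notin> complex_spectrum (cycle_mat_L \<alpha>)) \<and>
     0 islimpt {z \<in> C_L_plus. \<exists>\<alpha>\<in>{0..<1}. z \<in> complex_spectrum (cycle_mat_L \<alpha>)}"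
proof (intro conjI)
  show "\<forall>\<alpha>1\<in>{0..<1}. \<forall>\<alpha>2\<in>{0..<1}. \<forall>\<alpha>3\<in>{0..<1}. \<forall>\<alpha>4\<in>{0..<1}. \<forall>a b :: real.
        Complex a b \<in> complex_spectrum (cycle_mat \<alpha>1 \<alpha>2 \<alpha>3 \<alpha>4) \<and> b \<noteq> 0 \<longrightarrow>
          (0 \<le> a \<and> a < 1) \<and> a + \<bar>b\<bar> \<le> 1 \<and> G a b \<ge> 0"
    using eigenvalue_conditions by blast
  show "\<forall>a b :: real. b > 0 \<and> 0 \<le> a \<and> a < 1 \<and> a + b < 1 \<and> G a b > 0 \<longrightarrow>
        (\<exists>\<alpha>1\<in>{0..<1}. \<exists>\<alpha>2\<in>{0..<1}. \<exists>\<alpha>3\<in>{0..<1}. \<exists>\<alpha>4\<in>{0..<1}.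
           Complex a b \<in> complex_spectrum (cycle_mat \<alpha>1 \<alpha>2 \<alpha>3 \<alpha>4))"
    using interior_point_realized by blast
  show "\<forall>a b :: real. b < 0 \<and> 0 \<le> a \<and> a < 1 \<and> a + \<bar>b\<bar> < 1 \<and> G a b > 0 \<longrightarrow>
        (\<exists>\<alpha>1\<in>{0..<1}. \<exists>\<alpha>2\<in>{0..<1}. \<exists>\<alpha>3\<in>{0..<1}. \<exists>\<alpha>4\<in>{0..<1}.
           Complex a b \<in> complex_spectrum (cycle_mat \<alpha>1 \<alpha>2 \<alpha>3 \<alpha>4))"
  proof (intro allI impI)
    fix a b :: real
    assume ab: "b < 0 \<and> 0 \<le> a \<and> a < 1 \<and> a + \<bar>b\<bar> < 1 \<and> G a b > 0"
    then obtain \<alpha>1 \<alpha>2 \<alpha>3 \<alpha>4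
      where \<alpha>: "\<alpha>1 \<in> {0..<1}" "\<alpha>2 \<in> {0..<1}" "\<alpha>3 \<in> {0..<1}" "\<alpha>4 \<in> {0..<1}"
        and spec: "Complex a (- b) \<in> complex_spectrum (cycle_mat \<alpha>1 \<alpha>2 \<alpha>3 \<alpha>4)"
      using interior_point_realized[of "- b" a] by auto
    have "Complex a b \<in> complex_spectrum (cycle_mat \<alpha>1 \<alpha>2 \<alpha>3 \<alpha>4)"
      using complex_spectrum_cycle_mat_cnj[OF _ _ _ _ spec] \<alpha> by auto
    with \<alpha> show "\<exists>\<alpha>1\<in>{0..<1}. \<exists>\<alpha>2\<in>{0..<1}. \<exists>\<alpha>3\<in>{0..<1}. \<exists>\<alpha>4\<in>{0..<1}.
           Complex a b \<in> complex_spectrum (cycle_mat \<alpha>1 \<alpha>2 \<alpha>3 \<alpha>4)" by blast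
  qed
  show "\<forall>x\<in>{0<..1 :: real}.
        Complex (1 - x) x \<in> complex_spectrum (cycle_mat (1 - x) (1 - x) (1 - x) (1 - x))"
  proof
    fix x :: real assume x: "x \<in> {0<..1}"
    have "Complex (1 - x) x - complex_of_real (1 - x) = \<i> * of_real x"
      by (simp add: complex_eq_iff)
    with x show "Complex (1 - x) x \<in> complex_spectrum (cycle_mat (1 - x) (1 - x) (1 - x) (1 - x))"
      by (subst complex_spectrum_cycle_mat_iff) (auto simp: algebra_simps)
  qed
  have "1 \<in> complex_spectrum (cycle_mat 0 0 0 0)"
    by (subst complex_spectrum_cycle_mat_iff) auto
  then show "\<exists>\<alpha>1\<in>{0..<1}. \<exists>\<alpha>2\<in>{0..<1}. \<exists>\<alpha>3\<in>{0..<1}. \<exists>\<alpha>4\<in>{0..<1}.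
        1 \<in> complex_spectrum (cycle_mat \<alpha>1 \<alpha>2 \<alpha>3 \<alpha>4)"
    by (intro bexI[of _ 0]) auto
  show "\<forall>z\<in>C_L_plus. \<exists>\<alpha>\<in>{0..<1}. z \<in> complex_spectrum (cycle_mat_L \<alpha>)"
    using C_L_plus_realized by blast
  show "\<forall>\<alpha>\<in>{0..<1}. 0 \<notin> complex_spectrum (cycle_mat_L \<alpha>)"
    using zero_not_in_spectrum_cycle_mat_L by auto
  have "{z \<in> C_L_plus. \<exists>\<alpha>\<in>{0..<1}. z \<in> complex_spectrum (cycle_mat_L \<alpha>)} = C_L_plus"
    using C_L_plus_realized by blast
  then show "0 islimpt {z \<in> C_L_plus. \<exists>\<alpha>\<in>{0..<1}. z \<in> complex_spectrum (cycle_mat_L \<alpha>)}"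
    using zero_islimpt_C_L_plus by simp
qed

end
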